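(* Let $m\ge 1$ be an integer. For all $h>0$ it holds that $$S_{\theta\text{-Mar}}(\theta,h)\subset S_{\mathrm{SDE}}\ \text{ for } 0\le\theta<1/2,\qquad S_{\theta\text{-Mar}}(\theta,h)=S_{\mathrm{SDE}}\ \text{ for }\theta=1/2,\qquad S_{\theta\text{-Mar}}(\theta,h)\supset S_{\mathrm{SDE}}\ \text{ for }\theta>1/2 .$$ In particular, for $\theta\ge 1/2$ the $\theta$-Maruyama method is A-stable in mean-square, i.e. $S_{\mathrm{SDE}}\subseteq S_{\theta\text{-Mar}}(\theta,h)$ for all $h>0$. For $0\le\theta<1/2$ and $(\lambda,\mu_1,\dots,\mu_m)\in S_{\mathrm{SDE}}$, the stability condition $$\mathrm{Re}(\lambda)+\frac12\sum_{r=1}^m|\mu_r|^2+\frac12h(1-2\theta)|\lambda|^2<0$$ for the $\theta$-Maruyama method is satisfied if and only if $$h<\frac{-2\big(\mathrm{Re}(\lambda)+\frac12\sum_{r=1}^m|\mu_r|^2\big)}{(1-2\theta)|\lambda|^2}.$$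
   Context: Here $\subset$ and $\supset$ denote proper inclusion, $\subseteq$ inclusion. $S_{\mathrm{SDE}}$ is the set of $(\lambda,\mu_1,\dots,\mu_m)\in\mathbb{C}^{m+1}$ with $\mathrm{Re}(\lambda)+\frac12\sum_{r=1}^m|\mu_r|^2<0$; this is exactly the set of parameters for which the zero solution of the scalar Itô SDE $dX(t)=\lambda X(t)\,dt+\sum_{r=1}^m\mu_rX(t)\,dW_r(t)$ (independent standard real Wiener processes $W_r$) is asymptotically mean-square stable. The $\theta$-Maruyama method applied to this SDE with step-size $h$ is $$X_{i+1}=X_i+h\big(\theta\lambda X_{i+1}+(1-\theta)\lambda X_i\big)+\sqrt{h}\sum_{r=1}^m\mu_r X_i\,\xi_{r,i},\qquad i=0,1,\dots,$$ with mutually independent $\mathcal N(0,1)$ real random variables $\xi_{r,i}$ and non-random $X_0\in\mathbb{C}$; it is assumed that $1-\theta h\lambda\ne0$ so that the equation is uniquely solvable. $S_{\theta\text{-Mar}}(\theta,h)$ is the set of $(\lambda,\mu_1,\dots,\mu_m)\in\mathbb{C}^{m+1}$ with $1-\theta h\lambda\neq0$ for which the zero solution of the method is asymptotically stable in mean square, i.e. $\mathbb{E}|X_i|^2\to0$ as $i\to\infty$ for every solution $(X_i)$ with initial value $X_0\in\mathbb{C}$. *)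

theory Defs
  imports "HOL-Probability.Probability"
begin

text \<open>
  A parameter vector \<open>(\<lambda>, \<mu>\<^sub>1, \<dots>, \<mu>\<^sub>m)\<close> is a pair \<open>(lam, \<mu>)\<close> of type \<open>complex \<times> (complex ^ 'm)\<close>;
  the number \<open>m \<ge> 1\<close> of driving Wiener processes is \<open>CARD('m)\<close>.
\<close>

definition S_SDE :: "(complex \<times> (complex ^ 'm::finite)) set" where
  "S_SDE = {(lam, \<mu>). Re lam + 1/2 * (\<Sum>r\<in>UNIV. (cmod (\<mu> $ r))\<^sup>2) < 0}"

text \<open>
  \<open>\<xi> r i\<close> is the normalised increment of the \<open>r\<close>-th Wiener process in step \<open>i\<close>; all of them,
  over \<open>r\<close> and \<open>i\<close> jointly, are mutually independent.
\<close>

definition std_normal_noise :: "'a measure \<Rightarrow> ('m::finite \<Rightarrow> nat \<Rightarrow> 'a \<Rightarrow> real) \<Rightarrow> bool" where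
  "std_normal_noise M \<xi> \<longleftrightarrow>
     prob_space.indep_vars M (\<lambda>_. borel) (\<lambda>(r, i). \<xi> r i) UNIV \<and>
     (\<forall>r i. distributed M lborel (\<xi> r i) std_normal_density)"

definition theta_maruyama_solution ::
  "'a measure \<Rightarrow> ('m::finite \<Rightarrow> nat \<Rightarrow> 'a \<Rightarrow> real) \<Rightarrow> real \<Rightarrow> real \<Rightarrow>
   complex \<Rightarrow> complex ^ 'm \<Rightarrow> complex \<Rightarrow> (nat \<Rightarrow> 'a \<Rightarrow> complex) \<Rightarrow> bool" where
  "theta_maruyama_solution M \<xi> \<theta> h lam \<mu> x0 X \<longleftrightarrow>
     (\<forall>\<omega>\<in>space M. X 0 \<omega> = x0) \<and>
     (\<forall>i. \<forall>\<omega>\<in>space M.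
        X (Suc i) \<omega> = X i \<omega>
          + of_real h * (of_real \<theta> * lam * X (Suc i) \<omega> + of_real (1 - \<theta>) * lam * X i \<omega>)
          + of_real (sqrt h) * (\<Sum>r\<in>UNIV. \<mu> $ r * X i \<omega> * of_real (\<xi> r i \<omega>)))"

text \<open>
  The second moment is taken as a nonnegative integral, so that an infinite moment has
  value \<open>\<infinity>\<close> rather than the default value \<open>0\<close> of the Bochner integral. Solutions are
  automatically measurable when \<open>1 - \<theta> h \<lambda> \<noteq> 0\<close> and the noise is.
\<close>

definition theta_maruyama_ms_stable ::
  "'a measure \<Rightarrow> ('m::finite \<Rightarrow> nat \<Rightarrow> 'a \<Rightarrow> real) \<Rightarrow> real \<Rightarrow> real \<Rightarrow>
   complex \<Rightarrow> complex ^ 'm \<Rightarrow> bool" where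
  "theta_maruyama_ms_stable M \<xi> \<theta> h lam \<mu> \<longleftrightarrow>
     (\<forall>x0 X. theta_maruyama_solution M \<xi> \<theta> h lam \<mu> x0 X \<longrightarrow>
        (\<lambda>i. \<integral>\<^sup>+ \<omega>. ennreal ((cmod (X i \<omega>))\<^sup>2) \<partial>M) \<longlonglongrightarrow> 0)"

definition S_theta_Mar ::
  "'a measure \<Rightarrow> ('m::finite \<Rightarrow> nat \<Rightarrow> 'a \<Rightarrow> real) \<Rightarrow> real \<Rightarrow> real \<Rightarrow>
   (complex \<times> (complex ^ 'm)) set" where
  "S_theta_Mar M \<xi> \<theta> h =
     {(lam, \<mu>). 1 - of_real \<theta> * of_real h * lam \<noteq> 0 \<and>
                theta_maruyama_ms_stable M \<xi> \<theta> h lam \<mu>}"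

definition theta_maruyama_A_stable ::
  "'a measure \<Rightarrow> ('m::finite \<Rightarrow> nat \<Rightarrow> 'a \<Rightarrow> real) \<Rightarrow> real \<Rightarrow> bool" where
  "theta_maruyama_A_stable M \<xi> \<theta> \<longleftrightarrow> (\<forall>h>0. S_SDE \<subseteq> S_theta_Mar M \<xi> \<theta> h)"

end

theory Submission imports Defs begin

text \<open>
  Solved for the new iterate, the method multiplies by independent, identically distributed
  factors, so \<open>E|X\<^sub>i|\<^sup>2\<close> is geometric with ratio
  \<open>(|1 + (1 - \<theta>) h \<lambda>|\<^sup>2 + h \<Sum>|\<mu>\<^sub>r|\<^sup>2) / |1 - \<theta> h \<lambda>|\<^sup>2\<close>. Clearing the denominator, the ratio is
  below 1 iff \<open>Re \<lambda> + 1/2 \<Sum>|\<mu>\<^sub>r|\<^sup>2 + 1/2 h (1 - 2 \<theta>) |\<lambda>|\<^sup>2 < 0\<close>, so everything depends on the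
  sign of \<open>1 - 2 \<theta>\<close>. Strictness of the inclusions is witnessed with \<open>\<mu> = 0\<close>, by a large
  negative real \<open>\<lambda>\<close> for \<open>\<theta> < 1/2\<close> and by \<open>\<lambda> = \<i>\<close> for \<open>\<theta> > 1/2\<close>.
\<close>

section \<open>Second moments of affine functions of the noise\<close>

lemma (in prob_space) expectation_square_affine_orthonormal:
  fixes \<zeta> :: "'r::finite \<Rightarrow> 'a \<Rightarrow> real"
  assumes int1: "\<And>r. integrable M (\<zeta> r)" and int2: "\<And>r s. integrable M (\<lambda>\<omega>. \<zeta> r \<omega> * \<zeta> s \<omega>)"
    and mean: "\<And>r. expectation (\<zeta> r) = 0"
    and cov: "\<And>r s. expectation (\<lambda>\<omega>. \<zeta> r \<omega> * \<zeta> s \<omega>) = (if r = s then 1 else 0)"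
  shows "integrable M (\<lambda>\<omega>. (c + (\<Sum>r\<in>UNIV. d r * \<zeta> r \<omega>))\<^sup>2)"
    and "expectation (\<lambda>\<omega>. (c + (\<Sum>r\<in>UNIV. d r * \<zeta> r \<omega>))\<^sup>2) = c\<^sup>2 + (\<Sum>r\<in>UNIV. (d r)\<^sup>2)"
proof -
  \<comment> \<open>After this expansion linearity of the expectation suffices: the linear sum has
    mean zero, and orthonormality leaves only the diagonal of the double sum. Independence is not
    involved, only uncorrelatedness.\<close>
  have expand: "(c + (\<Sum>r\<in>UNIV. d r * \<zeta> r \<omega>))\<^sup>2 = c\<^sup>2 + (\<Sum>r\<in>UNIV. (2 * c * d r) * \<zeta> r \<omega>)
      + (\<Sum>r\<in>UNIV. \<Sum>s\<in>UNIV. (d r * d s) * (\<zeta> r \<omega> * \<zeta> s \<omega>))" for \<omega>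
    by (simp add: power2_sum power2_eq_square[of "sum _ _"] sum_product sum_distrib_left
        mult_ac)
  show "integrable M (\<lambda>\<omega>. (c + (\<Sum>r\<in>UNIV. d r * \<zeta> r \<omega>))\<^sup>2)"
    unfolding expand by (intro Bochner_Integration.integrable_add Bochner_Integration.integrable_sum
        integrable_mult_right int1 int2) auto
  have "(\<Sum>s\<in>UNIV. d r * d s * (if r = s then 1 else 0)) = (d r)\<^sup>2" for r
    by (simp add: power2_eq_square if_distrib[of "\<lambda>x. _ * x"] cong: if_cong)
  then show "expectation (\<lambda>\<omega>. (c + (\<Sum>r\<in>UNIV. d r * \<zeta> r \<omega>))\<^sup>2) = c\<^sup>2 + (\<Sum>r\<in>UNIV. (d r)\<^sup>2)"
    unfolding expand
    by (simp add: int1 int2 mean cov prob_space)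
qed

text \<open>The noise is real, so the real and the imaginary part are each a real affine combination
  of the same \<open>\<zeta> r\<close>; the real case applies to both, and their squares add up to
  the squared modulus.\<close>

lemma (in prob_space) nn_integral_cmod_square_affine_orthonormal:
  fixes \<zeta> :: "'r::finite \<Rightarrow> 'a \<Rightarrow> real"
  assumes "\<And>r. integrable M (\<zeta> r)" and "\<And>r s. integrable M (\<lambda>\<omega>. \<zeta> r \<omega> * \<zeta> s \<omega>)"
    and "\<And>r. expectation (\<zeta> r) = 0"
    and "\<And>r s. expectation (\<lambda>\<omega>. \<zeta> r \<omega> * \<zeta> s \<omega>) = (if r = s then 1 else 0)"
  shows "(\<integral>\<^sup>+\<omega>. ennreal ((cmod (a + (\<Sum>r\<in>UNIV. b r * of_real (\<zeta> r \<omega>))))\<^sup>2) \<partial>M)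
    = ennreal ((cmod a)\<^sup>2 + (\<Sum>r\<in>UNIV. (cmod (b r))\<^sup>2))"
proof -
  note sq = expectation_square_affine_orthonormal[of \<zeta>, OF assms]
  have split: "(cmod (a + (\<Sum>r\<in>UNIV. b r * of_real (\<zeta> r \<omega>))))\<^sup>2
      = (Re a + (\<Sum>r\<in>UNIV. Re (b r) * \<zeta> r \<omega>))\<^sup>2 + (Im a + (\<Sum>r\<in>UNIV. Im (b r) * \<zeta> r \<omega>))\<^sup>2" for \<omega>
    by (simp add: cmod_power2)
  show ?thesis
    unfolding split
    by (subst nn_integral_eq_integral) (simp_all add: sq cmod_power2 sum.distrib algebra_simps)
qed

text \<open>Supplies the orthonormality needed above for the noise of one fixed step
  \<open>i\<close>: the diagonal is the variance of a standard normal variable, the off-diagonal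
  vanishes by independence and zero mean.\<close>

lemma (in prob_space) std_normal_noise_moments:
  assumes noise: "std_normal_noise M \<xi>"
  shows "integrable M (\<xi> r i)"
    and "integrable M (\<lambda>\<omega>. \<xi> r i \<omega> * \<xi> s i \<omega>)"
    and "expectation (\<xi> r i) = 0"
    and "expectation (\<lambda>\<omega>. \<xi> r i \<omega> * \<xi> s i \<omega>) = (if r = s then 1 else 0)"
proof -
  have D: "distributed M lborel (\<xi> r i) std_normal_density" for r
    using noise by (simp add: std_normal_noise_def)
  have int1: "integrable M (\<xi> r i)" for r
    using integrable_std_normal_moment[of 1] distributed_integrable[OF D, of "\<lambda>x. x"] by simp
  have int2: "integrable M (\<lambda>\<omega>. (\<xi> r i \<omega>)\<^sup>2)" for r
    using integrable_std_normal_moment[of 2] distributed_integrable[OF D, of "\<lambda>x. x\<^sup>2"] by simp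
  have mean: "expectation (\<xi> r i) = 0" for r
    by (rule standard_normal_distributed_expectation[OF D])
  have var: "expectation (\<lambda>\<omega>. (\<xi> r i \<omega>)\<^sup>2) = 1"
    using standard_normal_distributed_variance[OF D, of r] by (simp add: mean)
  show "integrable M (\<xi> r i)" "expectation (\<xi> r i) = 0"
    by (fact int1, fact mean)
  have off_diag: "integrable M (\<lambda>\<omega>. \<xi> r i \<omega> * \<xi> s i \<omega>)
      \<and> expectation (\<lambda>\<omega>. \<xi> r i \<omega> * \<xi> s i \<omega>) = 0" if "r \<noteq> s"
  proof -
    \<comment> \<open>For \<open>r \<noteq> s\<close> this set has two distinct elements, so the
      product over it is exactly \<open>\<xi> r i * \<xi> s i\<close>.\<close>
    let ?I = "{(r, i), (s, i)}"
    have ind: "indep_vars (\<lambda>_. borel) (\<lambda>(r, i). \<xi> r i) ?I"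
      using noise by (auto simp: std_normal_noise_def intro: indep_vars_subset)
    have int: "integrable M ((\<lambda>(r, i). \<xi> r i) p)" if "p \<in> ?I" for p
      using that int1 by auto
    show ?thesis
      using indep_vars_integrable[OF _ ind int] indep_vars_lebesgue_integral[OF _ ind int]
        \<open>r \<noteq> s\<close> by (simp add: mean)
  qed
  show "integrable M (\<lambda>\<omega>. \<xi> r i \<omega> * \<xi> s i \<omega>)"
    using off_diag int2 by (cases "r = s") (simp_all add: power2_eq_square)
  show "expectation (\<lambda>\<omega>. \<xi> r i \<omega> * \<xi> s i \<omega>) = (if r = s then 1 else 0)"
    using off_diag var by (auto simp: power2_eq_square)
qed

text \<open>The \<open>j\<close>-th factor reads only the noise of step \<open>j\<close>. Different
  steps use disjoint blocks of a jointly independent family, so the factors are independent, the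
  integral of the product splits, and each factor contributes the same value.\<close>

lemma (in prob_space) nn_integral_prod_affine_noise:
  assumes noise: "std_normal_noise M \<xi>"
  shows "(\<integral>\<^sup>+\<omega>. (\<Prod>j<n. ennreal ((cmod (a + (\<Sum>r\<in>UNIV. b r * of_real (\<xi> r j \<omega>))))\<^sup>2)) \<partial>M)
    = ennreal (((cmod a)\<^sup>2 + (\<Sum>r\<in>UNIV. (cmod (b r))\<^sup>2)) ^ n)"
proof -
  \<comment> \<open>\<open>?K j\<close> is the block of all noise indices of step \<open>j\<close>.
    Since \<open>?f j\<close> looks only at coordinates in \<open>?K j\<close>, restricting the
    family to the block does not change its value.\<close>
  let ?K = "\<lambda>j::nat. (UNIV :: 'b set) \<times> {j}"
  let ?f = "\<lambda>j \<phi>. ennreal ((cmod (a + (\<Sum>r\<in>UNIV. b r * of_real (\<phi> (r, j)))))\<^sup>2)"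
  have "indep_vars (\<lambda>j. PiM (?K j) (\<lambda>_. borel))
      (\<lambda>j \<omega>. restrict (\<lambda>p. (case p of (r, i) \<Rightarrow> \<xi> r i) \<omega>) (?K j)) {..<n}"
    using noise by (intro indep_vars_restrict[where I=UNIV])
      (auto simp: std_normal_noise_def disjoint_family_on_def)
  then have "indep_vars (\<lambda>_. borel)
      (\<lambda>j \<omega>. ?f j (restrict (\<lambda>p. (case p of (r, i) \<Rightarrow> \<xi> r i) \<omega>) (?K j))) {..<n}"
  proof (rule indep_vars_compose2)
    fix j
    have [measurable]: "(\<lambda>\<phi>. \<phi> (r, j)) \<in> borel_measurable (PiM (?K j) (\<lambda>_. borel :: real measure))" for r
      by (rule measurable_component_singleton) simp
    show "?f j \<in> borel_measurable (PiM (?K j) (\<lambda>_. borel))"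
      by measurable
  qed
  then have ind: "indep_vars (\<lambda>_. borel)
      (\<lambda>j \<omega>. ennreal ((cmod (a + (\<Sum>r\<in>UNIV. b r * of_real (\<xi> r j \<omega>))))\<^sup>2)) {..<n}"
    by simp
  show ?thesis
    by (simp add: indep_vars_nn_integral[OF _ ind]
        nn_integral_cmod_square_affine_orthonormal std_normal_noise_moments[OF noise]
        ennreal_power sum_nonneg flip: ennreal_plus)
qed

section \<open>Solutions as products of random factors, and their mean-square growth\<close>

lemma theta_maruyama_solution_iff:
  assumes D: "1 - of_real \<theta> * of_real h * lam \<noteq> 0"
  shows "theta_maruyama_solution M \<xi> \<theta> h lam \<mu> x0 X \<longleftrightarrow>
    (\<forall>n. \<forall>\<omega>\<in>space M. X n \<omega> = x0 * (\<Prod>j<n.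
        (1 + of_real (1 - \<theta>) * of_real h * lam) / (1 - of_real \<theta> * of_real h * lam)
        + (\<Sum>r\<in>UNIV. (of_real (sqrt h) * \<mu> $ r / (1 - of_real \<theta> * of_real h * lam))
            * of_real (\<xi> r j \<omega>))))"
    (is "_ \<longleftrightarrow> (\<forall>n. \<forall>\<omega>\<in>space M. X n \<omega> = x0 * (\<Prod>j<n. ?A + ?B j \<omega>))")
proof -
  let ?D = "1 - of_real \<theta> * of_real h * lam"
  \<comment> \<open>Collecting the terms in \<open>y\<close> turns the implicit step into an
    equation for \<open>?D * y\<close>, and \<open>?D\<close> can be cancelled. The equivalence
    serves two purposes: it describes any given solution, and it shows that the product formula
    defines one.\<close>
  have step: "y = x + of_real h * (of_real \<theta> * lam * y + of_real (1 - \<theta>) * lam * x)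
          + of_real (sqrt h) * (\<Sum>r\<in>UNIV. \<mu> $ r * x * of_real (\<xi> r j \<omega>))
      \<longleftrightarrow> y = x * (?A + ?B j \<omega>)" for x y j \<omega>
  proof -
    have A: "?D * ?A = 1 + of_real (1 - \<theta>) * of_real h * lam"
      using D by simp
    have B: "?D * ?B j \<omega> = of_real (sqrt h) * (\<Sum>r\<in>UNIV. \<mu> $ r * of_real (\<xi> r j \<omega>))"
      using D by (simp add: sum_distrib_left mult_ac)
    have S: "(\<Sum>r\<in>UNIV. \<mu> $ r * x * of_real (\<xi> r j \<omega>)) = x * (\<Sum>r\<in>UNIV. \<mu> $ r * of_real (\<xi> r j \<omega>))"
      by (simp add: sum_distrib_left mult_ac)
    have "y = x * (?A + ?B j \<omega>) \<longleftrightarrow> ?D * y = ?D * (x * (?A + ?B j \<omega>))"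
      using D by simp
    also have "?D * (x * (?A + ?B j \<omega>)) = x * (?D * ?A + ?D * ?B j \<omega>)"
      by (simp only: distrib_left mult.left_commute)
    finally show ?thesis
      unfolding A B S by (auto simp: algebra_simps)
  qed
  show ?thesis
    unfolding theta_maruyama_solution_def step
  proof safe
    fix n \<omega>
    assume "\<forall>\<omega>\<in>space M. X 0 \<omega> = x0" "\<forall>i. \<forall>\<omega>\<in>space M. X (Suc i) \<omega> = X i \<omega> * (?A + ?B i \<omega>)"
      and "\<omega> \<in> space M"
    then show "X n \<omega> = x0 * (\<Prod>j<n. ?A + ?B j \<omega>)"
      by (induction n) (simp_all add: mult.assoc)
  next
    fix \<omega> assume *: "\<forall>n. \<forall>\<omega>\<in>space M. X n \<omega> = x0 * (\<Prod>j<n. ?A + ?B j \<omega>)" "\<omega> \<in> space M"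
    then have "X 0 \<omega> = x0 * (\<Prod>j<0. ?A + ?B j \<omega>)" by blast
    then show "X 0 \<omega> = x0" by simp
  next
    fix i \<omega> assume *: "\<forall>n. \<forall>\<omega>\<in>space M. X n \<omega> = x0 * (\<Prod>j<n. ?A + ?B j \<omega>)" "\<omega> \<in> space M"
    then have "X (Suc i) \<omega> = x0 * (\<Prod>j<Suc i. ?A + ?B j \<omega>)" by blast
    also have "\<dots> = X i \<omega> * (?A + ?B i \<omega>)"
      by (simp only: *(1)[rule_format, OF *(2), of i] prod.lessThan_Suc mult.assoc)
    finally show "X (Suc i) \<omega> = X i \<omega> * (?A + ?B i \<omega>)" .
  qed
qed

lemma (in prob_space) theta_maruyama_second_moment:
  assumes noise: "std_normal_noise M \<xi>"
    and D: "1 - of_real \<theta> * of_real h * lam \<noteq> 0" and "0 \<le> h"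
    and X: "theta_maruyama_solution M \<xi> \<theta> h lam \<mu> x0 X"
  shows "(\<integral>\<^sup>+\<omega>. ennreal ((cmod (X n \<omega>))\<^sup>2) \<partial>M) = ennreal ((cmod x0)\<^sup>2 *
     (((cmod (1 + of_real (1 - \<theta>) * of_real h * lam))\<^sup>2 + h * (\<Sum>r\<in>UNIV. (cmod (\<mu> $ r))\<^sup>2))
        / (cmod (1 - of_real \<theta> * of_real h * lam))\<^sup>2) ^ n)"
proof -
  define A where "A = (1 + of_real (1 - \<theta>) * of_real h * lam) / (1 - of_real \<theta> * of_real h * lam)"
  define B where "B r = of_real (sqrt h) * \<mu> $ r / (1 - of_real \<theta> * of_real h * lam)" for r
  \<comment> \<open>The factor \<open>h\<close> in front of the sum is the squared modulus of
    \<open>sqrt h\<close>, which is where \<open>0 \<le> h\<close> enters.\<close>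
  have ratio: "(cmod A)\<^sup>2 + (\<Sum>r\<in>UNIV. (cmod (B r))\<^sup>2)
     = ((cmod (1 + of_real (1 - \<theta>) * of_real h * lam))\<^sup>2 + h * (\<Sum>r\<in>UNIV. (cmod (\<mu> $ r))\<^sup>2))
        / (cmod (1 - of_real \<theta> * of_real h * lam))\<^sup>2"
    using \<open>0 \<le> h\<close> unfolding A_def B_def add_divide_distrib[of "(cmod _)\<^sup>2"]
    by (simp add: norm_divide norm_mult power_divide power_mult_distrib sum_distrib_left
        sum_divide_distrib del: of_real_diff)
  have meas: "\<xi> r i \<in> borel_measurable M" for r i
    using std_normal_noise_moments(1)[OF noise] by auto
  have "(\<integral>\<^sup>+\<omega>. ennreal ((cmod (X n \<omega>))\<^sup>2) \<partial>M)
      = (\<integral>\<^sup>+\<omega>. ennreal ((cmod x0)\<^sup>2)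
          * (\<Prod>j<n. ennreal ((cmod (A + (\<Sum>r\<in>UNIV. B r * of_real (\<xi> r j \<omega>))))\<^sup>2)) \<partial>M)"
    using X unfolding theta_maruyama_solution_iff[OF D]
    by (intro nn_integral_cong)
      (simp add: A_def B_def norm_mult power_mult_distrib prod_ennreal ennreal_mult prod_nonneg
        flip: prod_norm prod_power_distrib)
  also have "\<dots> = ennreal ((cmod x0)\<^sup>2) * ennreal (((cmod A)\<^sup>2 + (\<Sum>r\<in>UNIV. (cmod (B r))\<^sup>2)) ^ n)"
    using meas by (subst nn_integral_cmult) (auto simp: nn_integral_prod_affine_noise[OF noise])
  finally show ?thesis
    by (simp add: ratio ennreal_mult')
qed

text \<open>The second moments form a geometric sequence with ratio \<open>N / E\<close>, so
  stability means \<open>N < E\<close>, and \<open>N - E\<close> is a positive multiple of the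
  left-hand side of the condition.\<close>

lemma (in prob_space) theta_maruyama_ms_stable_iff:
  assumes noise: "std_normal_noise M \<xi>"
    and D: "1 - of_real \<theta> * of_real h * lam \<noteq> 0" and h: "0 < h"
  shows "theta_maruyama_ms_stable M \<xi> \<theta> h lam \<mu> \<longleftrightarrow>
    Re lam + 1/2 * (\<Sum>r\<in>UNIV. (cmod (\<mu> $ r))\<^sup>2) + 1/2 * h * (1 - 2 * \<theta>) * (cmod lam)\<^sup>2 < 0"
    (is "_ \<longleftrightarrow> ?cond < 0")
proof -
  define N where "N = (cmod (1 + of_real (1 - \<theta>) * of_real h * lam))\<^sup>2 + h * (\<Sum>r\<in>UNIV. (cmod (\<mu> $ r))\<^sup>2)"
  define E where "E = (cmod (1 - of_real \<theta> * of_real h * lam))\<^sup>2"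
  have E: "0 < E" using D by (simp add: E_def)
  have N: "0 \<le> N" using h by (simp add: N_def sum_nonneg)
  \<comment> \<open>The constants cancel, the linear terms combine to \<open>2 * h * Re lam\<close>,
    and the quadratic ones leave the factor
    \<open>(1 - \<theta>)\<^sup>2 - \<theta>\<^sup>2 = 1 - 2 * \<theta>\<close>.\<close>
  have "N - E = 2 * h * ?cond"
    unfolding N_def E_def cmod_power2 by (simp add: power2_eq_square algebra_simps)
  then have "?cond < 0 \<longleftrightarrow> N - E < 0"
    using h by (simp only: mult_less_0_iff) simp
  then have cond: "?cond < 0 \<longleftrightarrow> N / E < 1"
    using E by simp
  have moment: "(\<lambda>i. \<integral>\<^sup>+\<omega>. ennreal ((cmod (X i \<omega>))\<^sup>2) \<partial>M) \<longlonglongrightarrow> 0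
      \<longleftrightarrow> (\<lambda>i. (cmod x0)\<^sup>2 * (N / E) ^ i) \<longlonglongrightarrow> 0"
    if "theta_maruyama_solution M \<xi> \<theta> h lam \<mu> x0 X" for x0 X
    unfolding theta_maruyama_second_moment[OF noise D less_imp_le[OF h] that]
      N_def[symmetric] E_def[symmetric]
    using N E by (subst ennreal_tendsto_0_iff) auto
  show ?thesis
    unfolding cond
  proof
    assume "theta_maruyama_ms_stable M \<xi> \<theta> h lam \<mu>"
    \<comment> \<open>Stability quantifies over all solutions and would be vacuous without one. The
      initial value 1 makes the second moments the bare powers of \<open>N / E\<close>.\<close>
    moreover have "\<exists>X. theta_maruyama_solution M \<xi> \<theta> h lam \<mu> 1 X"
      unfolding theta_maruyama_solution_iff[OF D] by (rule exI) (rule allI, rule ballI, rule refl)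
    ultimately have "(\<lambda>i. (N / E) ^ i) \<longlonglongrightarrow> 0"
      unfolding theta_maruyama_ms_stable_def using moment[of 1] by auto
    then have "\<not> 1 \<le> N / E"
      using LIMSEQ_le_const[of "\<lambda>i. (N / E) ^ i" 0 1] one_le_power[of "N / E"] by auto
    then show "N / E < 1" by simp
  next
    assume "N / E < 1"
    then have "(\<lambda>i. (N / E) ^ i) \<longlonglongrightarrow> 0"
      using N E by (intro LIMSEQ_power_zero) auto
    then have "(\<lambda>i. (cmod x0)\<^sup>2 * (N / E) ^ i) \<longlonglongrightarrow> 0" for x0
      by (rule tendsto_mult_right_zero)
    then show "theta_maruyama_ms_stable M \<xi> \<theta> h lam \<mu>"
      unfolding theta_maruyama_ms_stable_def using moment by blast
  qed
qed

lemma (in prob_space) mem_S_theta_Mar_iff: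
  assumes "std_normal_noise M \<xi>" and "0 < h"
  shows "(lam, \<mu>) \<in> S_theta_Mar M \<xi> \<theta> h \<longleftrightarrow> 1 - of_real \<theta> * of_real h * lam \<noteq> 0 \<and>
    Re lam + 1/2 * (\<Sum>r\<in>UNIV. (cmod (\<mu> $ r))\<^sup>2) + 1/2 * h * (1 - 2 * \<theta>) * (cmod lam)\<^sup>2 < 0"
  using theta_maruyama_ms_stable_iff[OF assms(1) _ assms(2)] by (auto simp: S_theta_Mar_def)

section \<open>Comparison of the two stability regions\<close>

lemma S_SDE_Re_neg: "(lam, \<mu>) \<in> S_SDE \<Longrightarrow> Re lam < 0"
  using sum_nonneg[of UNIV "\<lambda>r. (cmod (\<mu> $ r))\<^sup>2"] by (simp add: S_SDE_def)

lemma one_minus_theta_h_lam_nonzero: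
  assumes "Re lam \<le> 0" and "0 \<le> \<theta>" and "0 \<le> h"
  shows "1 - of_real \<theta> * of_real h * lam \<noteq> 0"
proof
  assume "1 - of_real \<theta> * of_real h * lam = 0"
  then have "Re (1 - of_real \<theta> * of_real h * lam) = 0"
    by simp
  then have "\<theta> * h * Re lam = 1"
    by (simp add: mult.assoc)
  moreover have "\<theta> * h * Re lam \<le> 0"
    using assms by (simp add: mult_nonneg_nonpos)
  ultimately show False by simp
qed

theorem corollary3p3:
  fixes M :: "'a measure"
    and \<xi> :: "'m::finite \<Rightarrow> nat \<Rightarrow> 'a \<Rightarrow> real"
  assumes "prob_space M"
    and "std_normal_noise M \<xi>"
  shows
    "(\<forall>h>0. \<forall>\<theta>.
        (0 \<le> \<theta> \<and> \<theta> < 1/2 \<longrightarrow> S_theta_Mar M \<xi> \<theta> h \<subset> S_SDE) \<and>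
        (\<theta> = 1/2 \<longrightarrow> S_theta_Mar M \<xi> \<theta> h = S_SDE) \<and>
        (\<theta> > 1/2 \<longrightarrow> S_theta_Mar M \<xi> \<theta> h \<supset> S_SDE))
     \<and> (\<forall>\<theta>\<ge>1/2. theta_maruyama_A_stable M \<xi> \<theta>)
     \<and> (\<forall>h>0. \<forall>\<theta> lam. \<forall>\<mu> :: complex ^ 'm.
        0 \<le> \<theta> \<and> \<theta> < 1/2 \<and> (lam, \<mu>) \<in> S_SDE \<longrightarrow>
        (Re lam + 1/2 * (\<Sum>r\<in>UNIV. (cmod (\<mu> $ r))\<^sup>2)
            + 1/2 * h * (1 - 2 * \<theta>) * (cmod lam)\<^sup>2 < 0
         \<longleftrightarrow> h < - 2 * (Re lam + 1/2 * (\<Sum>r\<in>UNIV. (cmod (\<mu> $ r))\<^sup>2))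
                  / ((1 - 2 * \<theta>) * (cmod lam)\<^sup>2)))"
proof -
  interpret prob_space M by fact
  let ?S = "\<lambda>\<mu> :: complex ^ 'm. \<Sum>r\<in>UNIV. (cmod (\<mu> $ r))\<^sup>2"
  note Mar = mem_S_theta_Mar_iff[OF assms(2)]
  have SDE: "(lam, \<mu>) \<in> S_SDE \<longleftrightarrow> Re lam + 1/2 * ?S \<mu> < 0" for lam and \<mu> :: "complex ^ 'm"
    by (simp add: S_SDE_def)
  \<comment> \<open>This inclusion and the next both admit \<open>\<theta> = 1/2\<close>, where
    together they give equality.\<close>
  have Mar_le: "S_theta_Mar M \<xi> \<theta> h \<subseteq> S_SDE" if "0 < h" "\<theta> \<le> 1/2" for h \<theta>
  proof clarify
    fix lam \<mu> assume "(lam, \<mu>) \<in> S_theta_Mar M \<xi> \<theta> h"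
    moreover have "0 \<le> 1/2 * h * (1 - 2 * \<theta>) * (cmod lam)\<^sup>2"
      using that by simp
    ultimately show "(lam, \<mu>) \<in> S_SDE"
      unfolding Mar[OF that(1)] SDE by linarith
  qed
  have SDE_le: "S_SDE \<subseteq> S_theta_Mar M \<xi> \<theta> h" if "0 < h" "1/2 \<le> \<theta>" for h \<theta>
  proof clarify
    fix lam and \<mu> :: "complex ^ 'm" assume *: "(lam, \<mu>) \<in> S_SDE"
    then have "1 - of_real \<theta> * of_real h * lam \<noteq> 0"
      using that S_SDE_Re_neg[OF *] by (intro one_minus_theta_h_lam_nonzero) auto
    moreover have "1/2 * h * (1 - 2 * \<theta>) * (cmod lam)\<^sup>2 \<le> 0"
      using that by (intro mult_nonpos_nonneg mult_nonneg_nonpos) auto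
    ultimately show "(lam, \<mu>) \<in> S_theta_Mar M \<xi> \<theta> h"
      using * unfolding Mar[OF that(1)] SDE by linarith
  qed
  have proper_lt: "S_theta_Mar M \<xi> \<theta> h \<noteq> S_SDE" if "0 < h" "\<theta> < 1/2" for h \<theta>
  proof -
    \<comment> \<open>\<open>R\<close> is chosen so that at \<open>lam = - R\<close>,
      \<open>\<mu> = 0\<close> the extra term equals \<open>R\<close> and cancels
      \<open>Re lam\<close>: the left-hand side of the condition is exactly 0, while the point lies
      in \<open>S_SDE\<close>.\<close>
    define R where "R = 2 / (h * (1 - 2 * \<theta>))"
    have R: "0 < R" "h * (1 - 2 * \<theta>) * R = 2"
      using that by (simp_all add: R_def)
    then have "1/2 * h * (1 - 2 * \<theta>) * R\<^sup>2 = R"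
      by (simp add: power2_eq_square)
    then have "(of_real (- R), 0) \<notin> S_theta_Mar M \<xi> \<theta> h"
      using R by (simp add: Mar[OF that(1)])
    moreover have "(of_real (- R), 0 :: complex ^ 'm) \<in> S_SDE"
      using R by (simp add: SDE)
    ultimately show ?thesis by metis
  qed
  have proper_gt: "S_SDE \<noteq> S_theta_Mar M \<xi> \<theta> h" if "0 < h" "1/2 < \<theta>" for h \<theta>
  proof -
    \<comment> \<open>At \<open>lam = \<i>\<close>, \<open>\<mu> = 0\<close> the SDE expression is
      0, so the point just misses \<open>S_SDE\<close>, whereas the extra term is negative for
      \<open>\<theta> > 1/2\<close>.\<close>
    have "1 - of_real \<theta> * of_real h * \<i> \<noteq> 0"
      using that by (intro one_minus_theta_h_lam_nonzero) auto
    then have "(\<i>, 0) \<in> S_theta_Mar M \<xi> \<theta> h"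
      using that by (simp add: Mar[OF that(1)] mult_pos_neg)
    moreover have "(\<i>, 0 :: complex ^ 'm) \<notin> S_SDE"
      by (simp add: SDE)
    ultimately show ?thesis by metis
  qed
  have step_size: "Re lam + 1/2 * ?S \<mu> + 1/2 * h * (1 - 2 * \<theta>) * (cmod lam)\<^sup>2 < 0
      \<longleftrightarrow> h < - 2 * (Re lam + 1/2 * ?S \<mu>) / ((1 - 2 * \<theta>) * (cmod lam)\<^sup>2)"
    if "\<theta> < 1/2" "(lam, \<mu>) \<in> S_SDE" for h \<theta> lam \<mu>
  proof -
    \<comment> \<open>This makes the denominator positive, so that multiplying it out preserves the
      inequality; a zero denominator would turn the bound into the default value 0.\<close>
    have "lam \<noteq> 0"
      using S_SDE_Re_neg[OF that(2)] by auto
    then have "0 < (1 - 2 * \<theta>) * (cmod lam)\<^sup>2"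
      using that by simp
    then show ?thesis
      by (simp add: pos_less_divide_eq mult.assoc) linarith
  qed
  show ?thesis
    unfolding theta_maruyama_A_stable_def psubset_eq
    by (intro conjI allI impI)
      (use Mar_le SDE_le proper_lt proper_gt step_size in \<open>simp_all add: subset_antisym\<close>)
qed

end
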